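(* Let $k,r\ge 1$ and $d_1,\dots,d_k\ge 1$ be integers, and let $r_i=\min(r,d_i)$ for all $i$. The restricted maps $$\mathrm{O}_{d_1,\dots,d_k}(\mathbb{R})\times\mathcal{S}_r(r_1,\dots,r_k)\to\mathcal{S}_r(d_1,\dots,d_k),$$ $$\mathrm{O}_{d_1,\dots,d_k}(\mathbb{R})\times\overline{\mathcal{S}}_r(r_1,\dots,r_k)\to\overline{\mathcal{S}}_r(d_1,\dots,d_k),$$ given by $((L_1,\dots,L_k),A)\mapsto(L_1,\dots,L_k)\cdot A$, are both surjective.
   Context: $\mathbb{R}^{d_1\times\dots\times d_k}\cong\mathbb{R}^{d_1}\otimes\dots\otimes\mathbb{R}^{d_k}$ is the space of real $k$-way arrays; $\mathbf{x}_1\otimes\dots\otimes\mathbf{x}_k$ is the array with entries $x^{(1)}_{j_1}\cdots x^{(k)}_{j_k}$ (a decomposable tensor). The outer-product rank $\operatorname{rank}_{\otimes}(A)$ is the least $r\ge 0$ such that $A$ is a sum of $r$ decomposable tensors. $\mathcal{S}_r(d_1,\dots,d_k)=\{A\in\mathbb{R}^{d_1\times\dots\times d_k}:\operatorname{rank}_\otimes(A)\le r\}$, and $\overline{\mathcal{S}}_r(d_1,\dots,d_k)$ is its closure in $\mathbb{R}^{d_1\times\dots\times d_k}$ (norm topology). For $c_i\le d_i$, $\mathbb{R}^{c_1\times\dots\times c_k}$ is regarded as a subspace of $\mathbb{R}^{d_1\times\dots\times d_k}$ by padding arrays with zeros (the tensor product of the embeddings $\mathbb{R}^{c_i}\subseteq\mathbb{R}^{d_i}$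 as first $c_i$ coordinates). $\mathrm{O}_{d_1,\dots,d_k}(\mathbb{R})=\mathrm{O}_{d_1}(\mathbb{R})\times\dots\times\mathrm{O}_{d_k}(\mathbb{R})$ is the product of orthogonal groups, acting by $(L_1,\dots,L_k)\cdot(\mathbf{x}_1\otimes\dots\otimes\mathbf{x}_k)=L_1\mathbf{x}_1\otimes\dots\otimes L_k\mathbf{x}_k$, extended linearly. *)

theory Defs
  imports
    "HOL-Library.FuncSet"
    "HOL-Analysis.L2_Norm"
    "HOL-Analysis.Abstract_Metric_Spaces"
    "Jordan_Normal_Form.Matrix"
begin

text \<open>
  The dimensions \<open>d\<^sub>1, \<dots>, d\<^sub>k\<close> are given by a function \<open>d :: nat \<Rightarrow> nat\<close>, of which only the values
  at \<open>0, \<dots>, k - 1\<close> are used; all indices start at 0.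
\<close>

definition multi_indices :: "nat \<Rightarrow> (nat \<Rightarrow> nat) \<Rightarrow> (nat \<Rightarrow> nat) set" where
  "multi_indices k d = (\<Pi>\<^sub>E i\<in>{..<k}. {..<d i})"

text \<open>
  Arrays are functions that vanish outside the index range.  For \<open>c \<le> d\<close> an array of format
  \<open>c\<close> therefore literally is an array of format \<open>d\<close>: padding with zeros is set inclusion.
\<close>

definition arrays :: "nat \<Rightarrow> (nat \<Rightarrow> nat) \<Rightarrow> ((nat \<Rightarrow> nat) \<Rightarrow> real) set" where
  "arrays k d = {A. \<forall>j. j \<notin> multi_indices k d \<longrightarrow> A j = 0}"

definition outer :: "nat \<Rightarrow> (nat \<Rightarrow> nat) \<Rightarrow> (nat \<Rightarrow> real Matrix.vec) \<Rightarrow> (nat \<Rightarrow> nat) \<Rightarrow> real" where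
  "outer k d x j = (if j \<in> multi_indices k d then \<Prod>i<k. x i $ j i else 0)"

definition decomposable :: "nat \<Rightarrow> (nat \<Rightarrow> nat) \<Rightarrow> ((nat \<Rightarrow> nat) \<Rightarrow> real) set" where
  "decomposable k d = {outer k d x | x. \<forall>i<k. x i \<in> carrier_vec (d i)}"

definition outer_rank :: "nat \<Rightarrow> (nat \<Rightarrow> nat) \<Rightarrow> ((nat \<Rightarrow> nat) \<Rightarrow> real) \<Rightarrow> nat" where
  "outer_rank k d A =
     (LEAST r. \<exists>T. (\<forall>p<r. T p \<in> decomposable k d) \<and> A = (\<lambda>j. \<Sum>p<r. T p j))"

definition rank_le_set :: "nat \<Rightarrow> (nat \<Rightarrow> nat) \<Rightarrow> nat \<Rightarrow> ((nat \<Rightarrow> nat) \<Rightarrow> real) set" where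
  "rank_le_set k d r = {A \<in> arrays k d. outer_rank k d A \<le> r}"

definition array_dist ::
    "nat \<Rightarrow> (nat \<Rightarrow> nat) \<Rightarrow> ((nat \<Rightarrow> nat) \<Rightarrow> real) \<Rightarrow> ((nat \<Rightarrow> nat) \<Rightarrow> real) \<Rightarrow> real" where
  "array_dist k d A B = L2_set (\<lambda>j. A j - B j) (multi_indices k d)"

text \<open>
  All norms on the finite-dimensional space of arrays are equivalent; the Euclidean (Frobenius)
  norm is used to define the norm topology.
\<close>

definition array_topology :: "nat \<Rightarrow> (nat \<Rightarrow> nat) \<Rightarrow> ((nat \<Rightarrow> nat) \<Rightarrow> real) topology" where
  "array_topology k d = Metric_space.mtopology (arrays k d) (array_dist k d)"

definition border_rank_le_set :: "nat \<Rightarrow> (nat \<Rightarrow> nat) \<Rightarrow> nat \<Rightarrow> ((nat \<Rightarrow> nat) \<Rightarrow> real) set" where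
  "border_rank_le_set k d r = array_topology k d closure_of rank_le_set k d r"

definition orthogonal_mats :: "nat \<Rightarrow> real mat set" where
  "orthogonal_mats n =
     {L \<in> carrier_mat n n. L * transpose_mat L = 1\<^sub>m n \<and> transpose_mat L * L = 1\<^sub>m n}"

definition orthogonal_tuples :: "nat \<Rightarrow> (nat \<Rightarrow> nat) \<Rightarrow> (nat \<Rightarrow> real mat) set" where
  "orthogonal_tuples k d = (\<Pi>\<^sub>E i\<in>{..<k}. orthogonal_mats (d i))"

text \<open>
  The action in coordinates.  It is the linear map that sends the decomposable array of
  \<open>x\<^sub>1, \<dots>, x\<^sub>k\<close> to that of \<open>L\<^sub>1 x\<^sub>1, \<dots>, L\<^sub>k x\<^sub>k\<close> (lemmas \<open>multi_act_linear\<close> and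
  \<open>multi_act_outer\<close>); this determines it, as the decomposable arrays span.
\<close>

definition multi_act ::
    "nat \<Rightarrow> (nat \<Rightarrow> nat) \<Rightarrow> (nat \<Rightarrow> real mat) \<Rightarrow> ((nat \<Rightarrow> nat) \<Rightarrow> real) \<Rightarrow> (nat \<Rightarrow> nat) \<Rightarrow> real" where
  "multi_act k d L A j =
     (if j \<in> multi_indices k d
      then \<Sum>m\<in>multi_indices k d. (\<Prod>i<k. L i $$ (j i, m i)) * A m else 0)"

lemma finite_multi_indices [simp]: "finite (multi_indices k d)"
  by (simp add: multi_indices_def finite_PiE)

lemma arrays_mono:
  assumes "\<And>i. i < k \<Longrightarrow> c i \<le> d i"
  shows "arrays k c \<subseteq> arrays k d"
proof -
  have "multi_indices k c \<subseteq> multi_indices k d"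
    unfolding multi_indices_def using assms by (intro PiE_mono) auto
  then show ?thesis by (auto simp: arrays_def)
qed

lemma Metric_space_arrays: "Metric_space (arrays k d) (array_dist k d)"
proof
  fix A B C :: "(nat \<Rightarrow> nat) \<Rightarrow> real"
  show "0 \<le> array_dist k d A B" by (simp add: array_dist_def)
  show "array_dist k d A B = array_dist k d B A"
    by (simp add: array_dist_def L2_set_def power2_commute)
  show "array_dist k d A B = 0 \<longleftrightarrow> A = B" if "A \<in> arrays k d" "B \<in> arrays k d"
    using that by (fastforce simp: array_dist_def L2_set_eq_0_iff arrays_def)
  have "array_dist k d A C = L2_set (\<lambda>j. (A j - B j) + (B j - C j)) (multi_indices k d)"
    by (simp add: array_dist_def)
  also have "\<dots> \<le> array_dist k d A B + array_dist k d B C"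
    unfolding array_dist_def by (rule L2_set_triangle_ineq)
  finally show "array_dist k d A C \<le> array_dist k d A B + array_dist k d B C" .
qed

lemma multi_act_linear:
  "multi_act k d L (\<lambda>j. a * A j + b * B j) = (\<lambda>j. a * multi_act k d L A j + b * multi_act k d L B j)"
  by (auto simp: multi_act_def fun_eq_iff sum.distrib sum_distrib_left algebra_simps)

lemma multi_act_outer:
  assumes L: "\<And>i. i < k \<Longrightarrow> L i \<in> carrier_mat (d i) (d i)"
    and x: "\<And>i. i < k \<Longrightarrow> x i \<in> carrier_vec (d i)"
  shows "multi_act k d L (outer k d x) = outer k d (\<lambda>i. L i *\<^sub>v x i)"
proof
  fix j
  show "multi_act k d L (outer k d x) j = outer k d (\<lambda>i. L i *\<^sub>v x i) j"
  proof (cases "j \<in> multi_indices k d")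
    case True
    have "(L i *\<^sub>v x i) $ j i = (\<Sum>m<d i. L i $$ (j i, m) * x i $ m)" if "i < k" for i
    proof -
      have "j i < d i" using True that by (auto simp: multi_indices_def PiE_iff)
      then show ?thesis
        using L[OF that] x[OF that] by (auto simp: scalar_prod_def atLeast0LessThan intro!: sum.cong)
    qed
    then have "(\<Prod>i<k. (L i *\<^sub>v x i) $ j i) = (\<Prod>i<k. \<Sum>m<d i. L i $$ (j i, m) * x i $ m)"
      by simp
    also have "\<dots> = (\<Sum>m\<in>multi_indices k d. \<Prod>i<k. L i $$ (j i, m i) * x i $ m i)"
      unfolding multi_indices_def by (rule prod_sum_PiE) auto
    finally show ?thesis
      using True by (simp add: multi_act_def outer_def prod.distrib)
  qed (simp add: multi_act_def outer_def)
qed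

lemma outer_rank_attained:
  assumes "k \<ge> 1" and A: "A \<in> arrays k d"
  shows "\<exists>T. (\<forall>p<outer_rank k d A. T p \<in> decomposable k d)
           \<and> A = (\<lambda>j. \<Sum>p<outer_rank k d A. T p j)"
proof -
  define n where "n = card (multi_indices k d)"
  obtain e where e: "bij_betw e {..<n} (multi_indices k d)"
    unfolding n_def using ex_bij_betw_nat_finite[OF finite_multi_indices]
    by (auto simp: atLeast0LessThan)
  define x where "x p i = (if i = 0 then A (e p) else 1) \<cdot>\<^sub>v unit_vec (d i) (e p i)" for p i
  have entry: "outer k d (x p) j = (if j = e p then A (e p) else 0)" if p: "p < n" for p j
  proof (cases "j \<in> multi_indices k d")
    case True
    have ep: "e p \<in> multi_indices k d" using e p by (auto simp: bij_betw_def)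
    have "x p i $ j i = (if i = 0 then A (e p) else 1) * (if j i = e p i then 1 else 0)"
      if "i < k" for i
      using True ep that by (auto simp: x_def multi_indices_def PiE_iff unit_vec_def)
    then have "(\<Prod>i<k. x p i $ j i)
        = (\<Prod>i<k. if i = 0 then A (e p) else 1) * (\<Prod>i<k. if j i = e p i then 1 else 0)"
      by (simp add: prod.distrib)
    also have "(\<Prod>i<k. if i = 0 then A (e p) else 1) = A (e p)"
      using \<open>k \<ge> 1\<close> by (simp add: prod.delta)
    also have "(\<Prod>i<k. if j i = e p i then 1 else 0) = (if j = e p then 1 else (0::real))"
    proof (cases "j = e p")
      case False
      then obtain i where "i < k" "j i \<noteq> e p i"
        using PiE_ext True ep unfolding multi_indices_def by (metis lessThan_iff)
      then have "\<exists>i\<in>{..<k}. (if j i = e p i then 1 else (0::real)) = 0" by auto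
      then show ?thesis using False by (simp add: prod_zero)
    qed simp
    finally show ?thesis using True by (simp add: outer_def)
  next
    case False
    then show ?thesis using e p by (auto simp: outer_def bij_betw_def)
  qed
  have "A j = (\<Sum>p<n. outer k d (x p) j)" for j
  proof -
    have "(\<Sum>p<n. outer k d (x p) j) = (\<Sum>p<n. if j = e p then A (e p) else 0)"
      by (intro sum.cong) (auto simp: entry)
    also have "\<dots> = (\<Sum>m\<in>multi_indices k d. if j = m then A m else 0)"
      using e by (rule sum.reindex_bij_betw)
    also have "\<dots> = A j" using A by (auto simp: arrays_def)
    finally show ?thesis by simp
  qed
  moreover have "outer k d (x p) \<in> decomposable k d" for p
    unfolding decomposable_def x_def by fastforce
  ultimately have "\<exists>T. (\<forall>p<n. T p \<in> decomposable k d) \<and> A = (\<lambda>j. \<Sum>p<n. T p j)"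
    by (intro exI[of _ "\<lambda>p. outer k d (x p)"]) auto
  then show ?thesis unfolding outer_rank_def by (rule LeastI)
qed

end

theory Submission
  imports Defs
begin

text \<open>
  If \<open>A\<close> is a sum of \<open>r\<close> decomposable arrays, then for each mode \<open>i\<close> a product of at most \<open>r\<close>
  Householder reflections rotates the \<open>r\<close> factors in \<open>\<real>\<^bsup>d i\<^esup>\<close> into the span of the first
  \<open>min r (d i)\<close> unit vectors; this gives surjectivity for the rank sets.  A point of the closure is
  a limit of arrays \<open>L\<^sub>n \<cdot> B\<^sub>n\<close> with \<open>B\<^sub>n\<close> in the small format.  As the orthogonal groups are compact,
  one may assume that \<open>L\<^sub>n\<close> converges, and then so does \<open>B\<^sub>n = L\<^sub>n\<^sup>T \<cdot> (L\<^sub>n \<cdot> B\<^sub>n)\<close>.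
\<close>

unbundle no vec_syntax

subsection \<open>Orthogonal matrices\<close>

lemma orthogonal_mats_carrier: "L \<in> orthogonal_mats n \<Longrightarrow> L \<in> carrier_mat n n"
  by (simp add: orthogonal_mats_def)

lemma orthogonal_mats_transpose: "L \<in> orthogonal_mats n \<Longrightarrow> transpose_mat L \<in> orthogonal_mats n"
  by (simp add: orthogonal_mats_def)

lemma one_in_orthogonal_mats: "1\<^sub>m n \<in> orthogonal_mats n"
  by (simp add: orthogonal_mats_def)

lemma orthogonal_mats_mult:
  assumes "L \<in> orthogonal_mats n" "M \<in> orthogonal_mats n"
  shows "L * M \<in> orthogonal_mats n"
proof -
  have carrier [simp]: "L \<in> carrier_mat n n" "M \<in> carrier_mat n n"
    "transpose_mat L \<in> carrier_mat n n" "transpose_mat M \<in> carrier_mat n n"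
    using assms by (auto simp: orthogonal_mats_def)
  have eqs: "L * transpose_mat L = 1\<^sub>m n" "transpose_mat L * L = 1\<^sub>m n"
    "M * transpose_mat M = 1\<^sub>m n" "transpose_mat M * M = 1\<^sub>m n"
    using assms by (auto simp: orthogonal_mats_def)
  have tr: "transpose_mat (L * M) = transpose_mat M * transpose_mat L"
    using carrier(1,2) by (rule transpose_mult)
  \<comment> \<open>The two required identities differ only by replacing \<open>L\<close>,
    \<open>M\<close> with \<open>transpose_mat M\<close>, \<open>transpose_mat L\<close>, so one
    claim serves both.\<close>
  have cancel: "X * Y * (transpose_mat Y * transpose_mat X) = 1\<^sub>m n"
    if "X \<in> carrier_mat n n" "Y \<in> carrier_mat n n"
      "X * transpose_mat X = 1\<^sub>m n" "Y * transpose_mat Y = 1\<^sub>m n" for X Y :: "real mat"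
  proof -
    have "X * Y * (transpose_mat Y * transpose_mat X)
        = X * (Y * (transpose_mat Y * transpose_mat X))"
      using that by (intro assoc_mult_mat) auto
    also have "Y * (transpose_mat Y * transpose_mat X) = Y * transpose_mat Y * transpose_mat X"
      using that by (intro assoc_mult_mat[symmetric]) auto
    finally show ?thesis using that by simp
  qed
  have "L * M * transpose_mat (L * M) = 1\<^sub>m n"
    unfolding tr by (rule cancel) (auto simp: eqs)
  moreover have "transpose_mat (L * M) * (L * M) = 1\<^sub>m n"
    unfolding tr using cancel[of "transpose_mat M" "transpose_mat L"] by (simp add: eqs)
  moreover have "L * M \<in> carrier_mat n n"
    using carrier(1,2) by (rule mult_carrier_mat)
  ultimately show ?thesis
    by (simp add: orthogonal_mats_def)
qed

text \<open>Orthonormality of rows and columns as polynomial equations in the entries: this form can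
  be checked directly for reflections and survives entrywise limits.\<close>

lemma orthogonal_mats_iff_entries:
  assumes "L \<in> carrier_mat n n"
  shows "L \<in> orthogonal_mats n \<longleftrightarrow>
    (\<forall>a<n. \<forall>b<n. (\<Sum>m<n. L $$ (a, m) * L $$ (b, m)) = (if a = b then 1 else 0)
               \<and> (\<Sum>m<n. L $$ (m, a) * L $$ (m, b)) = (if a = b then 1 else 0))"
proof -
  have "(L * transpose_mat L) $$ (a, b) = (\<Sum>m<n. L $$ (a, m) * L $$ (b, m))"
    "(transpose_mat L * L) $$ (a, b) = (\<Sum>m<n. L $$ (m, a) * L $$ (m, b))"
    if "a < n" "b < n" for a b
    using that assms by (auto simp: scalar_prod_def atLeast0LessThan)
  then show ?thesis
    using assms by (auto simp: orthogonal_mats_def mat_eq_iff)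
qed

text \<open>Each row has Euclidean norm 1. This is the boundedness half of the compactness of the
  orthogonal group.\<close>

lemma orthogonal_mats_entry_bound:
  assumes "L \<in> orthogonal_mats n" "a < n" "b < n"
  shows "\<bar>L $$ (a, b)\<bar> \<le> 1"
proof -
  have "(L $$ (a, b))\<^sup>2 \<le> (\<Sum>m<n. (L $$ (a, m))\<^sup>2)"
    using assms by (intro member_le_sum) auto
  also have "\<dots> = 1"
    using assms orthogonal_mats_iff_entries[OF orthogonal_mats_carrier[OF assms(1)]]
    by (simp add: power2_eq_square)
  finally show ?thesis by (simp add: abs_square_le_1)
qed

section \<open>Householder reflections and the compression of finitely many vectors\<close>

text \<open>If \<open>v = 0\<close>, then division by zero makes \<open>householder n v\<close> the identity matrix.\<close>

definition householder :: "nat \<Rightarrow> (nat \<Rightarrow> real) \<Rightarrow> real mat" where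
  "householder n v =
     mat n n (\<lambda>(a, b). (if a = b then 1 else 0) - 2 / (\<Sum>m<n. (v m)\<^sup>2) * v a * v b)"

lemma householder_orthogonal: "householder n v \<in> orthogonal_mats n"
proof -
  define s where "s = (\<Sum>m<n. (v m)\<^sup>2)"
  define t where "t = 2 / s"
  \<comment> \<open>Valid also for \<open>s = 0\<close>, since then \<open>t = 0\<close>. It cancels
    the quadratic term against the two mixed terms below.\<close>
  have t: "t * t * s = 2 * t" by (auto simp: t_def)
  have sum: "(\<Sum>m<n. ((if a = m then 1 else 0) - t * v a * v m) * ((if b = m then 1 else 0) - t * v b * v m))
      = (if a = b then 1 else 0)" if "a < n" "b < n" for a b
  proof -
    have "(\<Sum>m<n. ((if a = m then 1 else 0) - t * v a * v m) * ((if b = m then 1 else 0) - t * v b * v m))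
        = (\<Sum>m<n. (if a = m then (if b = m then 1 else 0) - t * v b * v m else 0)
            - (if b = m then t * v a * v m else 0) + t * t * v a * v b * (v m)\<^sup>2)"
      by (intro sum.cong) (auto simp: algebra_simps power2_eq_square)
    also have "\<dots> = (if b = a then 1 else 0) - t * v b * v a - t * v a * v b + t * t * v a * v b * s"
      using that by (simp add: sum.distrib sum_subtractf s_def flip: sum_distrib_left)
    also have "t * t * v a * v b * s = (t * t * s) * v a * v b" by simp
    finally show ?thesis by (auto simp: t)
  qed
  have entry: "householder n v $$ (a, b) = (if a = b then 1 else 0) - t * v a * v b"
    if "a < n" "b < n" for a b
    using that by (auto simp: householder_def t_def s_def)
  have carrier: "householder n v \<in> carrier_mat n n" by (simp add: householder_def)
  \<comment> \<open>The matrix is symmetric, so rows and columns lead to the same sum.\<close>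
  have "(\<Sum>m<n. householder n v $$ (a, m) * householder n v $$ (b, m)) = (if a = b then 1 else 0)"
    "(\<Sum>m<n. householder n v $$ (m, a) * householder n v $$ (m, b)) = (if a = b then 1 else 0)"
    if "a < n" "b < n" for a b
    unfolding sum[OF that, symmetric] using that
    by (auto intro!: sum.cong simp: entry mult_ac)
  then show ?thesis
    using orthogonal_mats_iff_entries[OF carrier] by blast
qed

lemma householder_mult_vec:
  assumes "y \<in> carrier_vec n" "a < n"
  shows "(householder n v *\<^sub>v y) $ a
      = y $ a - 2 / (\<Sum>m<n. (v m)\<^sup>2) * v a * (\<Sum>m<n. v m * y $ m)"
proof -
  define t where "t = 2 / (\<Sum>m<n. (v m)\<^sup>2)"
  have "(householder n v *\<^sub>v y) $ a
      = (\<Sum>m<n. (if a = m then y $ m else 0) - t * v a * (v m * y $ m))"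
    using assms
    by (auto simp: householder_def scalar_prod_def atLeast0LessThan algebra_simps
        simp flip: t_def intro!: sum.cong)
  also have "\<dots> = y $ a - t * v a * (\<Sum>m<n. v m * y $ m)"
    using assms by (simp add: sum_subtractf flip: sum_distrib_left)
  finally show ?thesis by (simp only: t_def)
qed

text \<open>The reflection is the one that maps the part of \<open>y\<close> beyond the first \<open>r\<close> coordinates to a
  multiple of the unit vector with index \<open>r\<close>.\<close>

lemma householder_step:
  assumes y: "y \<in> carrier_vec n" and "r < n"
  obtains H where "H \<in> orthogonal_mats n"
    and "\<And>a. r < a \<Longrightarrow> a < n \<Longrightarrow> (H *\<^sub>v y) $ a = 0"
    and "\<And>x a. x \<in> carrier_vec n \<Longrightarrow> (\<And>b. r \<le> b \<Longrightarrow> b < n \<Longrightarrow> x $ b = 0) \<Longrightarrow> H *\<^sub>v x = x"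
proof -
  \<comment> \<open>\<open>z\<close> is the tail of \<open>y\<close> from index \<open>r\<close> on
    and \<open>N\<close> its norm. The reflection along \<open>v\<close>, the difference of
    \<open>z\<close> and \<open>N\<close> times the unit vector with index \<open>r\<close>,
    exchanges these two vectors of equal length.\<close>
  define z where "z a = (if r \<le> a then y $ a else 0)" for a
  define N where "N = L2_set z {..<n}"
  define v where "v a = z a - (if a = r then N else 0)" for a
  define s where "s = (\<Sum>m<n. (v m)\<^sup>2)"
  have N: "N\<^sup>2 = (\<Sum>m<n. (z m)\<^sup>2)" by (simp add: N_def L2_set_def sum_nonneg)
  have vy: "(\<Sum>m<n. v m * y $ m) = N\<^sup>2 - N * z r"
  proof -
    have "(\<Sum>m<n. v m * y $ m) = (\<Sum>m<n. (z m)\<^sup>2 - (if m = r then N * z m else 0))"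
      by (intro sum.cong) (auto simp: v_def z_def power2_eq_square algebra_simps)
    then show ?thesis using \<open>r < n\<close> by (simp add: sum_subtractf N)
  qed
  \<comment> \<open>By \<open>vy\<close>, \<open>s\<close> is twice the inner product of
    \<open>v\<close> and \<open>y\<close>. For \<open>s \<noteq> 0\<close> the reflection therefore
    subtracts exactly \<open>v\<close> from \<open>y\<close>, which clears the entries beyond
    \<open>r\<close>.\<close>
  have s: "s = 2 * (N\<^sup>2 - N * z r)"
  proof -
    have "s = (\<Sum>m<n. (z m)\<^sup>2 + (if m = r then N\<^sup>2 - 2 * N * z m else 0))"
      unfolding s_def by (intro sum.cong) (auto simp: v_def power2_eq_square algebra_simps)
    then show ?thesis using \<open>r < n\<close> by (simp add: sum.distrib N[symmetric])
  qed
  show ?thesis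
  proof (rule that[of "householder n v"])
    show "householder n v \<in> orthogonal_mats n" by (rule householder_orthogonal)
    show "(householder n v *\<^sub>v y) $ a = 0" if a: "r < a" "a < n" for a
    proof -
      have va: "v a = y $ a" using a by (simp add: v_def z_def)
      have vy': "(\<Sum>m<n. v m * y $ m) = s / 2" by (simp add: vy s)
      have "(householder n v *\<^sub>v y) $ a = y $ a - 2 / s * v a * (s / 2)"
        unfolding householder_mult_vec[OF y a(2)] vy' s_def[symmetric] ..
      also have "\<dots> = 0"
      proof (cases "s = 0")
        \<comment> \<open>Here the reflection is the identity, but the vanishing of \<open>v\<close>
          says that these entries of \<open>y\<close> are zero already.\<close>
        case True
        then have "v a = 0" using a by (simp add: s_def sum_nonneg_eq_0_iff)
        then show ?thesis by (simp add: va)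
      qed (simp add: va)
      finally show ?thesis .
    qed
    show "householder n v *\<^sub>v x = x"
      if x: "x \<in> carrier_vec n" "\<And>b. r \<le> b \<Longrightarrow> b < n \<Longrightarrow> x $ b = 0" for x
    proof -
      \<comment> \<open>\<open>v\<close> lives on the indices from \<open>r\<close> on and
        \<open>x\<close> on those below \<open>r\<close>; the two are orthogonal, so
        \<open>x\<close> stays fixed.\<close>
      have "v m * x $ m = 0" if "m < n" for m
        using x(2)[OF _ that] \<open>r < n\<close> by (auto simp: v_def z_def)
      then have "(\<Sum>m<n. v m * x $ m) = 0" by (intro sum.neutral) auto
      then show ?thesis
        using x(1) householder_mult_vec[OF x(1), of _ v]
        by (intro eq_vecI) (auto simp: householder_def)
    qed
  qed
qed

text \<open>Induction on the number of vectors: once \<open>Q\<close> has brought the first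
  \<open>r\<close> vectors into the first \<open>r\<close> coordinates, a reflection acting only on
  the coordinates from \<open>r\<close> on brings the next vector into the first
  \<open>r + 1\<close> and leaves the earlier ones alone.\<close>

lemma orthogonal_compression:
  fixes x :: "nat \<Rightarrow> real Matrix.vec"
  assumes "\<And>p. p < r \<Longrightarrow> x p \<in> carrier_vec n"
  shows "\<exists>Q\<in>orthogonal_mats n. \<forall>p<r. \<forall>a. r \<le> a \<longrightarrow> a < n \<longrightarrow> (Q *\<^sub>v x p) $ a = 0"
  using assms
proof (induction r)
  case 0
  then show ?case using one_in_orthogonal_mats by auto
next
  case (Suc r)
  then obtain Q where Q: "Q \<in> orthogonal_mats n"
    and zero: "\<And>p a. p < r \<Longrightarrow> r \<le> a \<Longrightarrow> a < n \<Longrightarrow> (Q *\<^sub>v x p) $ a = 0"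
    by (meson less_Suc_eq)
  show ?case
  proof (cases "r < n")
    case True
    have Qc: "Q \<in> carrier_mat n n" using Q by (rule orthogonal_mats_carrier)
    have xc: "Q *\<^sub>v x p \<in> carrier_vec n" if "p < Suc r" for p
      using Qc Suc.prems[OF that] by simp
    obtain H where H: "H \<in> orthogonal_mats n"
      and new: "\<And>a. r < a \<Longrightarrow> a < n \<Longrightarrow> (H *\<^sub>v (Q *\<^sub>v x r)) $ a = 0"
      and old: "\<And>x a. x \<in> carrier_vec n \<Longrightarrow> (\<And>b. r \<le> b \<Longrightarrow> b < n \<Longrightarrow> x $ b = 0) \<Longrightarrow> H *\<^sub>v x = x"
      using householder_step[OF xc[of r] True] by blast
    have "((H * Q) *\<^sub>v x p) $ a = 0" if "p < Suc r" "Suc r \<le> a" "a < n" for p a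
    proof -
      have "(H * Q) *\<^sub>v x p = H *\<^sub>v (Q *\<^sub>v x p)"
        using orthogonal_mats_carrier[OF H] Qc Suc.prems[OF that(1)] by (rule assoc_mult_mat_vec)
      moreover have "H *\<^sub>v (Q *\<^sub>v x p) = Q *\<^sub>v x p" if "p < r"
        using that by (intro old xc zero) auto
      ultimately show ?thesis
        using that new[of a] zero[of p a] by (cases "p = r") auto
    qed
    then show ?thesis using orthogonal_mats_mult[OF H Q] by blast
  next
    \<comment> \<open>For \<open>n \<le> r\<close> no index satisfies \<open>Suc r \<le> a\<close>
      and \<open>a < n\<close>, so \<open>Q\<close> itself serves.\<close>
    case False
    then show ?thesis using Q by auto
  qed
qed

subsection \<open>Arrays of bounded rank\<close>

text \<open>Trades the minimum in \<open>outer_rank\<close> for a sum of exactly \<open>r\<close>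
  terms, on which matrices act term by term. A shorter minimal sum is filled up with zero
  arrays.\<close>

lemma rank_le_set_iff:
  assumes "k \<ge> 1"
  shows "A \<in> rank_le_set k d r \<longleftrightarrow>
    (\<exists>x. (\<forall>p<r. \<forall>i<k. x p i \<in> carrier_vec (d i)) \<and> A = (\<lambda>j. \<Sum>p<r. outer k d (x p) j))"
proof
  assume A: "A \<in> rank_le_set k d r"
  define n where "n = outer_rank k d A"
  have n: "n \<le> r" using A by (simp add: rank_le_set_def n_def)
  from A obtain T where T: "\<And>p. p < n \<Longrightarrow> T p \<in> decomposable k d"
    and A_eq: "A = (\<lambda>j. \<Sum>p<n. T p j)"
    using outer_rank_attained[OF assms, of A d] unfolding n_def rank_le_set_def by blast
  have "\<forall>p. \<exists>x. p < n \<longrightarrow> (\<forall>i<k. x i \<in> carrier_vec (d i)) \<and> T p = outer k d x"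
    using T unfolding decomposable_def by blast
  then obtain x where
    x: "\<And>p. p < n \<Longrightarrow> (\<forall>i<k. x p i \<in> carrier_vec (d i)) \<and> T p = outer k d (x p)"
    by metis
  define y where "y p i = (if p < n then x p i else 0\<^sub>v (d i))" for p i
  have zero: "outer k d (y p) j = 0" if "\<not> p < n" for p j
  proof -
    \<comment> \<open>A single zero factor kills the product; mode 0 is available because
      \<open>k \<ge> 1\<close>.\<close>
    have "y p 0 $ j 0 = 0" if "j \<in> multi_indices k d"
      using \<open>\<not> p < n\<close> that assms by (auto simp: y_def multi_indices_def PiE_iff)
    then show ?thesis
      using assms by (auto simp: outer_def intro!: prod_zero bexI[of _ 0])
  qed
  have "outer k d (y p) = T p" if "p < n" for p
    using x[OF that] that by (simp add: y_def outer_def fun_eq_iff)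
  then have "A = (\<lambda>j. \<Sum>p<r. outer k d (y p) j)"
    unfolding A_eq using n zero by (intro ext sum.mono_neutral_cong_left) auto
  moreover have "\<forall>p<r. \<forall>i<k. y p i \<in> carrier_vec (d i)"
    using x by (auto simp: y_def)
  ultimately show "\<exists>x. (\<forall>p<r. \<forall>i<k. x p i \<in> carrier_vec (d i))
      \<and> A = (\<lambda>j. \<Sum>p<r. outer k d (x p) j)" by blast
next
  assume "\<exists>x. (\<forall>p<r. \<forall>i<k. x p i \<in> carrier_vec (d i)) \<and> A = (\<lambda>j. \<Sum>p<r. outer k d (x p) j)"
  then obtain x where x: "\<forall>p<r. \<forall>i<k. x p i \<in> carrier_vec (d i)"
    and A: "A = (\<lambda>j. \<Sum>p<r. outer k d (x p) j)" by blast
  have "outer_rank k d A \<le> r"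
    unfolding outer_rank_def
  proof (rule Least_le, intro exI conjI)
    show "\<forall>p<r. outer k d (x p) \<in> decomposable k d"
      using x by (auto simp: decomposable_def)
  qed (rule A)
  moreover have "A \<in> arrays k d" by (simp add: A arrays_def outer_def)
  ultimately show "A \<in> rank_le_set k d r" by (simp add: rank_le_set_def)
qed

text \<open>At an index outside the small format some coordinate falls into the range where
  \<open>y i\<close> vanishes; inside it the factors agree. This serves both to pad vectors with
  zeros and to truncate them.\<close>

lemma outer_restrict:
  fixes x y :: "nat \<Rightarrow> real Matrix.vec"
  assumes "\<And>i. i < k \<Longrightarrow> c i \<le> d i"
    and "\<And>i a. i < k \<Longrightarrow> c i \<le> a \<Longrightarrow> a < d i \<Longrightarrow> y i $ a = 0"
    and "\<And>i a. i < k \<Longrightarrow> a < c i \<Longrightarrow> x i $ a = y i $ a"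
  shows "outer k d y = outer k c x"
proof
  fix j
  consider "j \<in> multi_indices k c" | "j \<in> multi_indices k d" "j \<notin> multi_indices k c"
    | "j \<notin> multi_indices k d" "j \<notin> multi_indices k c" by blast
  then show "outer k d y j = outer k c x j"
  proof cases
    case 1
    moreover have "multi_indices k c \<subseteq> multi_indices k d"
      unfolding multi_indices_def using assms(1) by (intro PiE_mono) auto
    ultimately have "j \<in> multi_indices k d" by blast
    then show ?thesis
      using 1 assms(3) by (auto simp: outer_def multi_indices_def PiE_iff intro!: prod.cong)
  next
    case 2
    then obtain i where "i < k" "c i \<le> j i" "j i < d i"
      by (force simp: multi_indices_def PiE_iff)
    then have "\<exists>i\<in>{..<k}. y i $ j i = 0" using assms(2) by auto
    then show ?thesis using 2 by (simp add: outer_def prod_zero)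
  qed (simp add: outer_def)
qed

lemma rank_le_set_mono:
  assumes k: "k \<ge> 1" and le: "\<And>i. i < k \<Longrightarrow> c i \<le> d i"
  shows "rank_le_set k c r \<subseteq> rank_le_set k d r"
proof
  fix A assume "A \<in> rank_le_set k c r"
  then obtain x where A: "A = (\<lambda>j. \<Sum>p<r. outer k c (x p) j)"
    by (auto simp: rank_le_set_iff[OF k])
  define y where "y p i = vec (d i) (\<lambda>a. if a < c i then x p i $ a else 0)" for p i
  have "outer k d (y p) = outer k c (x p)" for p
  proof (rule outer_restrict)
    fix i a assume "i < k" "a < c i"
    moreover from this have "a < d i" using le[of i] by simp
    ultimately show "x p i $ a = y p i $ a" by (simp add: y_def)
  qed (auto simp: y_def le)
  then show "A \<in> rank_le_set k d r"
    unfolding rank_le_set_iff[OF k] by (intro exI[of _ y]) (auto simp: A y_def)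
qed

subsection \<open>The action\<close>

lemma multi_act_cong:
  assumes "\<And>i. i < k \<Longrightarrow> L i = M i"
  shows "multi_act k d L = multi_act k d M"
  using assms by (simp add: multi_act_def fun_eq_iff)

lemma multi_act_sum_outer:
  assumes "\<And>i. i < k \<Longrightarrow> L i \<in> carrier_mat (d i) (d i)"
    and "\<forall>p<r. \<forall>i<k. x p i \<in> carrier_vec (d i)"
  shows "multi_act k d L (\<lambda>j. \<Sum>p<r. outer k d (x p) j)
    = (\<lambda>j. \<Sum>p<r. outer k d (\<lambda>i. L i *\<^sub>v x p i) j)"
proof -
  have "multi_act k d L (\<lambda>j. \<Sum>p<r. outer k d (x p) j)
      = (\<lambda>j. \<Sum>p<r. multi_act k d L (outer k d (x p)) j)"
    by (auto simp: multi_act_def fun_eq_iff sum_distrib_left intro: sum.swap)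
  also have "\<dots> = (\<lambda>j. \<Sum>p<r. outer k d (\<lambda>i. L i *\<^sub>v x p i) j)"
  proof (intro ext sum.cong refl)
    fix j p assume "p \<in> {..<r}"
    then have "multi_act k d L (outer k d (x p)) = outer k d (\<lambda>i. L i *\<^sub>v x p i)"
      using assms by (intro multi_act_outer) auto
    then show "multi_act k d L (outer k d (x p)) j = outer k d (\<lambda>i. L i *\<^sub>v x p i) j" by simp
  qed
  finally show ?thesis .
qed

lemma multi_act_rank_le_set:
  assumes k: "k \<ge> 1" and L: "\<And>i. i < k \<Longrightarrow> L i \<in> carrier_mat (d i) (d i)"
    and "A \<in> rank_le_set k d r"
  shows "multi_act k d L A \<in> rank_le_set k d r"
proof -
  obtain x where x: "\<forall>p<r. \<forall>i<k. x p i \<in> carrier_vec (d i)"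
    and A: "A = (\<lambda>j. \<Sum>p<r. outer k d (x p) j)"
    using assms(3) by (auto simp: rank_le_set_iff[OF k])
  have "multi_act k d L A = (\<lambda>j. \<Sum>p<r. outer k d (\<lambda>i. L i *\<^sub>v x p i) j)"
    unfolding A by (intro multi_act_sum_outer L x)
  then show ?thesis
    unfolding rank_le_set_iff[OF k]
    using L x by (intro exI[of _ "\<lambda>p i. L i *\<^sub>v x p i"]) (auto intro: mult_mat_vec_carrier)
qed

text \<open>In each mode one orthogonal matrix compresses the \<open>r\<close> factors of
  \<open>A\<close>, and \<open>L i\<close> is its transpose. The small array appears as an explicit
  expression in \<open>L\<close> and \<open>A\<close>, not as an unspecified witness, because the
  closure argument takes limits of it.\<close>

lemma rank_le_set_compression:
  assumes k: "k \<ge> 1" and c: "\<And>i. i < k \<Longrightarrow> c i = min r (d i)"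
    and "A \<in> rank_le_set k d r"
  shows "\<exists>L\<in>orthogonal_tuples k d.
    multi_act k d (\<lambda>i. transpose_mat (L i)) A \<in> rank_le_set k c r
    \<and> multi_act k d L (multi_act k d (\<lambda>i. transpose_mat (L i)) A) = A"
proof -
  obtain x where x: "\<forall>p<r. \<forall>i<k. x p i \<in> carrier_vec (d i)"
    and A: "A = (\<lambda>j. \<Sum>p<r. outer k d (x p) j)"
    using assms(3) by (auto simp: rank_le_set_iff[OF k])
  have "\<forall>i. \<exists>Q. i < k \<longrightarrow> Q \<in> orthogonal_mats (d i)
      \<and> (\<forall>p<r. \<forall>a. r \<le> a \<longrightarrow> a < d i \<longrightarrow> (Q *\<^sub>v x p i) $ a = 0)"
    using orthogonal_compression[of r "\<lambda>p. x p _"] x by meson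
  then obtain Q where Q: "\<And>i. i < k \<Longrightarrow> Q i \<in> orthogonal_mats (d i)"
    and zero: "\<And>i p a. i < k \<Longrightarrow> p < r \<Longrightarrow> r \<le> a \<Longrightarrow> a < d i \<Longrightarrow> (Q i *\<^sub>v x p i) $ a = 0"
    by metis
  \<comment> \<open>The restriction makes \<open>L\<close> extensional, as
    \<open>orthogonal_tuples\<close> demands.\<close>
  define L where "L = (\<lambda>i\<in>{..<k}. transpose_mat (Q i))"
  define B where "B = multi_act k d (\<lambda>i. transpose_mat (L i)) A"
  have L: "L \<in> orthogonal_tuples k d"
    using Q by (auto simp: L_def orthogonal_tuples_def orthogonal_mats_transpose)
  have Qc: "Q i \<in> carrier_mat (d i) (d i)" if "i < k" for i
    using Q[OF that] by (rule orthogonal_mats_carrier)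
  have Lc: "L i \<in> carrier_mat (d i) (d i)" if "i < k" for i
    using Qc[OF that] that by (simp add: L_def)
  have Qx: "\<forall>p<r. \<forall>i<k. Q i *\<^sub>v x p i \<in> carrier_vec (d i)"
    using Qc x by (auto intro: mult_mat_vec_carrier)
  \<comment> \<open>Beyond \<open>k\<close> the transposes of \<open>L\<close> may differ from
    \<open>Q\<close>; \<open>multi_act_cong\<close> disregards these indices.\<close>
  have "B = multi_act k d Q A"
    unfolding B_def using multi_act_cong[of k "\<lambda>i. transpose_mat (L i)" Q d]
    by (simp add: L_def)
  also have "\<dots> = (\<lambda>j. \<Sum>p<r. outer k d (\<lambda>i. Q i *\<^sub>v x p i) j)"
    unfolding A by (intro multi_act_sum_outer Qc x)
  finally have B: "B = (\<lambda>j. \<Sum>p<r. outer k d (\<lambda>i. Q i *\<^sub>v x p i) j)" .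
  define y where "y p i = vec (c i) (\<lambda>a. (Q i *\<^sub>v x p i) $ a)" for p i
  \<comment> \<open>Truncation loses nothing: an index \<open>a\<close> with
    \<open>c i \<le> a\<close> and \<open>a < d i\<close> forces \<open>c i = r\<close>, where
    \<open>zero\<close> applies.\<close>
  have "outer k d (\<lambda>i. Q i *\<^sub>v x p i) = outer k c (y p)" if "p < r" for p
    using zero that by (intro outer_restrict) (auto simp: y_def c)
  then have "B \<in> rank_le_set k c r"
    unfolding rank_le_set_iff[OF k] by (intro exI[of _ y]) (auto simp: B y_def)
  moreover have "multi_act k d L B = A"
  proof -
    have "L i *\<^sub>v (Q i *\<^sub>v x p i) = x p i" if "i < k" "p < r" for i p
    proof -
      have "L i *\<^sub>v (Q i *\<^sub>v x p i) = (L i * Q i) *\<^sub>v x p i"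
        using x that by (intro assoc_mult_mat_vec[OF Lc Qc, symmetric]) auto
      also have "L i * Q i = 1\<^sub>m (d i)"
        using Q that by (simp add: L_def orthogonal_mats_def)
      finally show ?thesis using x that by simp
    qed
    then have "outer k d (\<lambda>i. L i *\<^sub>v (Q i *\<^sub>v x p i)) = outer k d (x p)" if "p < r" for p
      using that by (simp add: outer_def fun_eq_iff)
    moreover have "multi_act k d L B = (\<lambda>j. \<Sum>p<r. outer k d (\<lambda>i. L i *\<^sub>v (Q i *\<^sub>v x p i)) j)"
      unfolding B by (intro multi_act_sum_outer Lc Qx)
    ultimately show ?thesis
      unfolding A by (auto intro!: sum.cong)
  qed
  ultimately show ?thesis using L unfolding B_def by blast
qed

text \<open>Each entry of the result is a polynomial in the matrix entries and the array entries, so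
  the action is jointly continuous.\<close>

lemma multi_act_tendsto:
  assumes "\<And>i a b. i < k \<Longrightarrow> a < d i \<Longrightarrow> b < d i \<Longrightarrow> (\<lambda>n. L n i $$ (a, b)) \<longlonglongrightarrow> M i $$ (a, b)"
    and "\<And>j. (\<lambda>n. X n j) \<longlonglongrightarrow> A j"
  shows "(\<lambda>n. multi_act k d (L n) (X n) j) \<longlonglongrightarrow> multi_act k d M A j"
proof (cases "j \<in> multi_indices k d")
  case True
  have "(\<lambda>n. \<Sum>m\<in>multi_indices k d. (\<Prod>i<k. L n i $$ (j i, m i)) * X n m)
      \<longlonglongrightarrow> (\<Sum>m\<in>multi_indices k d. (\<Prod>i<k. M i $$ (j i, m i)) * A m)"
    using True by (intro tendsto_intros assms) (auto simp: multi_indices_def PiE_iff)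
  then show ?thesis using True by (simp add: multi_act_def)
qed (simp add: multi_act_def)

subsection \<open>Closures and compactness\<close>

text \<open>With finitely many coordinates, convergence in the Frobenius metric is entrywise
  convergence, the form in which all limits below are taken.\<close>

lemma limitin_array_topology_iff:
  assumes "\<And>n. X n \<in> arrays k d" "A \<in> arrays k d"
  shows "limitin (array_topology k d) X A sequentially \<longleftrightarrow> (\<forall>j. (\<lambda>n. X n j) \<longlonglongrightarrow> A j)"
proof -
  interpret Metric_space "arrays k d" "array_dist k d" by (rule Metric_space_arrays)
  have lim: "limitin (array_topology k d) X A sequentially \<longleftrightarrow>
      (\<lambda>n. array_dist k d (X n) A) \<longlonglongrightarrow> 0"
    using assms by (simp add: array_topology_def limitin_metric_dist_null)
  show ?thesis
    unfolding lim
  proof (intro iffI allI)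
    fix j
    assume dist: "(\<lambda>n. array_dist k d (X n) A) \<longlonglongrightarrow> 0"
    show "(\<lambda>n. X n j) \<longlonglongrightarrow> A j"
    proof (cases "j \<in> multi_indices k d")
      case True
      have "norm (X n j - A j) \<le> array_dist k d (X n) A" for n
      proof -
        have "\<bar>X n j - A j\<bar> \<le> L2_set (\<lambda>j. \<bar>X n j - A j\<bar>) (multi_indices k d)"
          using member_le_L2_set[OF finite_multi_indices True, of "\<lambda>j. \<bar>X n j - A j\<bar>"] .
        then show ?thesis by (simp add: array_dist_def L2_set_def)
      qed
      then have "(\<lambda>n. X n j - A j) \<longlonglongrightarrow> 0"
        using dist by (intro Lim_null_comparison[OF _ dist]) auto
      then show ?thesis by (rule LIM_zero_cancel)
    next
      case False
      then show ?thesis using assms by (simp add: arrays_def)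
    qed
  next
    assume "\<forall>j. (\<lambda>n. X n j) \<longlonglongrightarrow> A j"
    then have "(\<lambda>n. array_dist k d (X n) A)
        \<longlonglongrightarrow> sqrt (\<Sum>j\<in>multi_indices k d. (A j - A j)\<^sup>2)"
      unfolding array_dist_def L2_set_def by (intro tendsto_intros) auto
    then show "(\<lambda>n. array_dist k d (X n) A) \<longlonglongrightarrow> 0" by simp
  qed
qed

text \<open>In a metric space the closure consists of the limits of sequences. That such an
  entrywise limit is again an array follows, since entries outside the index range remain
  zero.\<close>

lemma border_rank_le_set_iff:
  "A \<in> border_rank_le_set k d r \<longleftrightarrow>
    (\<exists>X. (\<forall>n. X n \<in> rank_le_set k d r) \<and> (\<forall>j. (\<lambda>n. X n j) \<longlonglongrightarrow> A j))"
proof -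
  interpret Metric_space "arrays k d" "array_dist k d" by (rule Metric_space_arrays)
  have sub: "rank_le_set k d r \<subseteq> arrays k d" by (auto simp: rank_le_set_def)
  have arr: "A \<in> arrays k d"
    if "\<And>n. X n \<in> rank_le_set k d r" "\<And>j. (\<lambda>n. X n j) \<longlonglongrightarrow> A j" for X
  proof -
    have "A j = 0" if "j \<notin> multi_indices k d" for j
    proof -
      have "X n j = 0" for n
        using \<open>\<And>n. X n \<in> rank_le_set k d r\<close> that by (auto simp: rank_le_set_def arrays_def)
      then show ?thesis
        using \<open>\<And>j. (\<lambda>n. X n j) \<longlonglongrightarrow> A j\<close>[of j] by (simp add: LIMSEQ_const_iff)
    qed
    then show ?thesis by (simp add: arrays_def)
  qed
  have "A \<in> border_rank_le_set k d r \<longleftrightarrow> A \<in> arrays k d \<and>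
     (\<exists>X. range X \<subseteq> rank_le_set k d r \<inter> arrays k d
       \<and> limitin (array_topology k d) X A sequentially)"
    unfolding border_rank_le_set_def array_topology_def
    by (simp add: closure_of_sequentially limitin_mspace)
  also have "\<dots> \<longleftrightarrow> A \<in> arrays k d \<and>
      (\<exists>X. (\<forall>n. X n \<in> rank_le_set k d r) \<and> (\<forall>j. (\<lambda>n. X n j) \<longlonglongrightarrow> A j))"
    using sub limitin_array_topology_iff[of _ k d A] by (auto simp: image_subset_iff) blast+
  finally show ?thesis using arr by blast
qed

section \<open>Sequential compactness of the orthogonal tuples\<close>

text \<open>Bolzano-Weierstrass applied to one index after another; each further subsequence keeps
  the convergence already obtained.\<close>

lemma finite_family_convergent_subseq:
  fixes f :: "nat \<Rightarrow> 'a \<Rightarrow> 'b :: heine_borel"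
  assumes "finite S" "\<And>s. s \<in> S \<Longrightarrow> bounded (range (\<lambda>n. f n s))"
  shows "\<exists>\<phi>. strict_mono \<phi> \<and> (\<forall>s\<in>S. convergent (\<lambda>n. f (\<phi> n) s))"
  using assms
proof (induction S rule: finite_induct)
  case empty
  then show ?case using strict_mono_id by auto
next
  case (insert s S)
  then obtain \<phi> where \<phi>: "strict_mono \<phi>" "\<forall>s\<in>S. convergent (\<lambda>n. f (\<phi> n) s)" by auto
  have "bounded (range (\<lambda>n. f (\<phi> n) s))"
    by (rule bounded_subset[OF insert.prems[of s]]) auto
  then obtain l \<psi> where \<psi>: "strict_mono \<psi>" "((\<lambda>n. f (\<phi> n) s) \<circ> \<psi>) \<longlonglongrightarrow> l"
    using bounded_imp_convergent_subsequence by blast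
  have "convergent (\<lambda>n. f (\<phi> (\<psi> n)) t)" if "t \<in> insert s S" for t
  proof (cases "t = s")
    case True
    then show ?thesis using \<psi>(2) by (auto simp: convergent_def o_def)
  next
    case False
    then show ?thesis
      using \<phi>(2) that convergent_subseq_convergent[OF _ \<psi>(1), of "\<lambda>n. f (\<phi> n) t"]
      by (auto simp: o_def)
  qed
  moreover have "strict_mono (\<lambda>n. \<phi> (\<psi> n))"
    using strict_mono_o[OF \<phi>(1) \<psi>(1)] by (simp add: o_def)
  ultimately show ?case by (intro exI[of _ "\<lambda>n. \<phi> (\<psi> n)"]) auto
qed

text \<open>There are finitely many entries, all bounded by 1, so a subsequence converges entrywise;
  the orthonormality equations are closed conditions and pass to the limit.\<close>

lemma orthogonal_tuples_compact:
  assumes L: "\<And>n::nat. L n \<in> orthogonal_tuples k d"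
  shows "\<exists>M\<in>orthogonal_tuples k d. \<exists>\<phi>. strict_mono \<phi> \<and>
    (\<forall>i<k. \<forall>a<d i. \<forall>b<d i. (\<lambda>n. L (\<phi> n) i $$ (a, b)) \<longlonglongrightarrow> M i $$ (a, b))"
proof -
  have Li: "L n i \<in> orthogonal_mats (d i)" if "i < k" for n i
    using L[of n] that by (auto simp: orthogonal_tuples_def)
  \<comment> \<open>\<open>S\<close> lists the matrix positions of all modes, so that one extraction
    handles the whole tuple.\<close>
  define S where "S = (SIGMA i:{..<k}. {..<d i} \<times> {..<d i})"
  define f where "f n = (\<lambda>(i, ab). L n i $$ ab)" for n
  have "bounded (range (\<lambda>n. f n s))" if "s \<in> S" for s
  proof (rule boundedI)
    fix y assume "y \<in> range (\<lambda>n. f n s)"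
    then show "norm y \<le> 1"
      using that orthogonal_mats_entry_bound[OF Li] by (auto simp: S_def f_def)
  qed
  then obtain \<phi> where \<phi>: "strict_mono \<phi>" and conv: "\<And>s. s \<in> S \<Longrightarrow> convergent (\<lambda>n. f (\<phi> n) s)"
    using finite_family_convergent_subseq[of S f] by (auto simp: S_def)
  define M where "M = (\<lambda>i\<in>{..<k}. mat (d i) (d i) (\<lambda>ab. lim (\<lambda>n. L (\<phi> n) i $$ ab)))"
  have lim: "(\<lambda>n. L (\<phi> n) i $$ (a, b)) \<longlonglongrightarrow> M i $$ (a, b)"
    if "i < k" "a < d i" "b < d i" for i a b
    using conv[of "(i, a, b)"] that by (simp add: M_def S_def f_def convergent_LIMSEQ_iff)
  have "M i \<in> orthogonal_mats (d i)" if i: "i < k" for i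
  proof -
    have Mc: "M i \<in> carrier_mat (d i) (d i)" using i by (simp add: M_def)
    have "(\<Sum>m<d i. M i $$ (a, m) * M i $$ (b, m)) = (if a = b then 1 else 0)
        \<and> (\<Sum>m<d i. M i $$ (m, a) * M i $$ (m, b)) = (if a = b then 1 else 0)"
      if ab: "a < d i" "b < d i" for a b
    proof -
      have "(\<lambda>n. \<Sum>m<d i. L (\<phi> n) i $$ (a, m) * L (\<phi> n) i $$ (b, m))
          \<longlonglongrightarrow> (\<Sum>m<d i. M i $$ (a, m) * M i $$ (b, m))"
        "(\<lambda>n. \<Sum>m<d i. L (\<phi> n) i $$ (m, a) * L (\<phi> n) i $$ (m, b))
          \<longlonglongrightarrow> (\<Sum>m<d i. M i $$ (m, a) * M i $$ (m, b))"
        using i ab by (auto intro!: tendsto_intros lim)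
      moreover have "(\<Sum>m<d i. L (\<phi> n) i $$ (a, m) * L (\<phi> n) i $$ (b, m)) = (if a = b then 1 else 0)
          \<and> (\<Sum>m<d i. L (\<phi> n) i $$ (m, a) * L (\<phi> n) i $$ (m, b)) = (if a = b then 1 else 0)" for n
        using Li[OF i, of "\<phi> n"] ab
          orthogonal_mats_iff_entries[OF orthogonal_mats_carrier[OF Li[OF i, of "\<phi> n"]]]
        by blast
      ultimately show ?thesis by (simp add: LIMSEQ_const_iff)
    qed
    then show ?thesis using orthogonal_mats_iff_entries[OF Mc] by blast
  qed
  then have "M \<in> orthogonal_tuples k d" by (auto simp: orthogonal_tuples_def M_def)
  then show ?thesis using \<phi> lim by blast
qed

text \<open>Equality with the image says both that the maps land in the stated targets and that they
  are onto.\<close>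

theorem theorem5p2:
  fixes k r :: nat and d c :: "nat \<Rightarrow> nat"
  assumes "k \<ge> 1" and "r \<ge> 1" and "\<And>i. i < k \<Longrightarrow> d i \<ge> 1"
    and "\<And>i. i < k \<Longrightarrow> c i = min r (d i)"
  shows "(\<lambda>(L, A). multi_act k d L A) ` (orthogonal_tuples k d \<times> rank_le_set k c r)
           = rank_le_set k d r
       \<and> (\<lambda>(L, A). multi_act k d L A) ` (orthogonal_tuples k d \<times> border_rank_le_set k c r)
           = border_rank_le_set k d r"
proof -
  note k = assms(1) and c = assms(4)
  have carrier: "L i \<in> carrier_mat (d i) (d i)" if "L \<in> orthogonal_tuples k d" "i < k" for L i
    using that by (auto simp: orthogonal_tuples_def intro: orthogonal_mats_carrier)
  \<comment> \<open>Padding is inclusion, so \<open>A\<close> itself already lies in the rank set of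
    the large format, which the action preserves.\<close>
  have act: "multi_act k d L A \<in> rank_le_set k d r"
    if "L \<in> orthogonal_tuples k d" "A \<in> rank_le_set k c r" for L A
    using rank_le_set_mono[OF k, of c d r] c that
    by (intro multi_act_rank_le_set[OF k carrier]) auto
  have "multi_act k d L A \<in> border_rank_le_set k d r"
    if L: "L \<in> orthogonal_tuples k d" and A: "A \<in> border_rank_le_set k c r" for L A
  proof -
    obtain X where X: "\<And>n. X n \<in> rank_le_set k c r" "\<And>j. (\<lambda>n. X n j) \<longlonglongrightarrow> A j"
      using A by (auto simp: border_rank_le_set_iff)
    have "(\<lambda>n. multi_act k d L (X n) j) \<longlonglongrightarrow> multi_act k d L A j" for j
      by (intro multi_act_tendsto X) simp
    then show ?thesis
      unfolding border_rank_le_set_iff using act[OF L X(1)]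
      by (intro exI[of _ "\<lambda>n. multi_act k d L (X n)"]) auto
  qed
  moreover have "\<exists>L\<in>orthogonal_tuples k d. \<exists>B\<in>border_rank_le_set k c r. multi_act k d L B = A"
    if A: "A \<in> border_rank_le_set k d r" for A
  proof -
    let ?t = "\<lambda>L i. transpose_mat (L i :: real mat)"
    obtain X where X: "\<And>n. X n \<in> rank_le_set k d r" "\<And>j. (\<lambda>n. X n j) \<longlonglongrightarrow> A j"
      using A by (auto simp: border_rank_le_set_iff)
    obtain L where L: "\<And>n. L n \<in> orthogonal_tuples k d"
      and small: "\<And>n. multi_act k d (?t (L n)) (X n) \<in> rank_le_set k c r"
      and undo: "\<And>n. multi_act k d (L n) (multi_act k d (?t (L n)) (X n)) = X n"
      using rank_le_set_compression[OF k c X(1)] by metis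
    \<comment> \<open>The rotations depend on \<open>n\<close>; compactness makes them converge
      along a subsequence.\<close>
    obtain M \<phi> where M: "M \<in> orthogonal_tuples k d" and \<phi>: "strict_mono \<phi>"
      and lim: "\<And>i a b. i < k \<Longrightarrow> a < d i \<Longrightarrow> b < d i \<Longrightarrow>
        (\<lambda>n. L (\<phi> n) i $$ (a, b)) \<longlonglongrightarrow> M i $$ (a, b)"
      using orthogonal_tuples_compact[of L, OF L] by blast
    have X\<phi>: "(\<lambda>n. X (\<phi> n) j) \<longlonglongrightarrow> A j" for j
      using LIMSEQ_subseq_LIMSEQ[OF X(2) \<phi>] by (simp add: o_def)
    \<comment> \<open>\<open>B\<close> is the limit of the compressed arrays, since both the
      transposes and the approximating arrays converge.\<close>
    define B where "B = multi_act k d (?t M) A"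
    have B: "(\<lambda>n. multi_act k d (?t (L (\<phi> n))) (X (\<phi> n)) j) \<longlonglongrightarrow> B j" for j
      unfolding B_def
    proof (intro multi_act_tendsto X\<phi>)
      fix i a b assume "i < k" "a < d i" "b < d i"
      then show "(\<lambda>n. ?t (L (\<phi> n)) i $$ (a, b)) \<longlonglongrightarrow> ?t M i $$ (a, b)"
        using lim[of i b a] carrier_matD[OF carrier[OF L]] carrier_matD[OF carrier[OF M]] by simp
    qed
    then have "B \<in> border_rank_le_set k c r"
      unfolding border_rank_le_set_iff using small
      by (intro exI[of _ "\<lambda>n. multi_act k d (?t (L (\<phi> n))) (X (\<phi> n))"]) auto
    moreover have "multi_act k d M B = A"
    proof
      fix j
      \<comment> \<open>By joint continuity these arrays tend to \<open>multi_act k d M B\<close>;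
        by \<open>undo\<close> they equal \<open>X (\<phi> n)\<close>, which tends to
        \<open>A\<close>.\<close>
      have "(\<lambda>n. multi_act k d (L (\<phi> n)) (multi_act k d (?t (L (\<phi> n))) (X (\<phi> n))) j)
          \<longlonglongrightarrow> multi_act k d M B j"
        by (intro multi_act_tendsto lim B)
      then have "(\<lambda>n. X (\<phi> n) j) \<longlonglongrightarrow> multi_act k d M B j" by (simp add: undo)
      then show "multi_act k d M B j = A j" using X\<phi>[of j] by (rule LIMSEQ_unique)
    qed
    ultimately show ?thesis using M by blast
  qed
  ultimately have "(\<lambda>(L, A). multi_act k d L A) ` (orthogonal_tuples k d \<times> border_rank_le_set k c r)
      = border_rank_le_set k d r" by fastforce
  moreover have "\<exists>L\<in>orthogonal_tuples k d. \<exists>B\<in>rank_le_set k c r. multi_act k d L B = A"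
    if "A \<in> rank_le_set k d r" for A
    using rank_le_set_compression[OF k c that] by blast
  with act have "(\<lambda>(L, A). multi_act k d L A) ` (orthogonal_tuples k d \<times> rank_le_set k c r)
      = rank_le_set k d r" by fastforce
  ultimately show ?thesis by simp
qed

end
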